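(* Let $n\ge 3$ be an integer and let $D=(\mathcal{W}_0,\mathcal{W}_1,\ldots,\mathcal{W}_n)\in\mathbb{C}^{n+1}$ be a non-zero vector. Let $P_D(\mathcal{Z}_0,\ldots,\mathcal{Z}_n)=\mathcal{W}_0\mathcal{Z}_0+\cdots+\mathcal{W}_n\mathcal{Z}_n$, let $c(D)>0$ be defined by $c(D)^2=(n+1)\|D\|^2$, and for integers $k\ge 0$ set $$a(n,k,D)=\sum_{\substack{\ell_0+\cdots+\ell_n=k\\ \ell_m\ge 0}}\binom{k}{\ell_0,\ell_1,\ldots,\ell_n}^2|\mathcal{W}_0|^{2\ell_0}\cdots|\mathcal{W}_n|^{2\ell_n}.$$ Then the logarithmic Mahler measure $m(P_D)$ is given by $$m(P_D)=\log c(D)-\frac12\sum_{j=1}^{\infty}\frac1j\sum_{k=0}^{j}\binom{j}{k}\frac{(-1)^k a(n,k,D)}{c(D)^{2k}}.$$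
   Context: $\|D\|^2=|\mathcal{W}_0|^2+\cdots+|\mathcal{W}_n|^2$, and $\binom{k}{\ell_0,\ldots,\ell_n}=\frac{k!}{\ell_0!\cdots\ell_n!}$ is the multinomial coefficient, with $|\mathcal{W}|^0=1$. The logarithmic Mahler measure of a non-zero polynomial $P\in\mathbb{C}[x_1,\ldots,x_N]$ is $$m(P)=\frac{1}{(2\pi)^N}\int_0^{2\pi}\cdots\int_0^{2\pi}\log|P(e^{i\theta_1},\ldots,e^{i\theta_N})|\,d\theta_1\cdots d\theta_N.$$ For the homogeneous linear form $P_D$ this equals $\frac{1}{(2\pi)^n}\int_0^{2\pi}\cdots\int_0^{2\pi}\log|P_D(1,e^{i\theta_1},\ldots,e^{i\theta_n})|\,d\theta_1\cdots d\theta_n$. *)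

theory Defs
  imports "HOL-Analysis.Analysis"
begin

text \<open>
  A polynomial in N complex variables enters through its polynomial function; the variables
  are indexed by \<open>0, \<dots>, N - 1\<close>, and only these coordinates of the argument are relevant.
\<close>

definition torus_point :: "(nat \<Rightarrow> real) \<Rightarrow> nat \<Rightarrow> complex" where
  "torus_point \<theta> = (\<lambda>i. exp (\<i> * complex_of_real (\<theta> i)))"

definition angle_box :: "nat \<Rightarrow> (nat \<Rightarrow> real) set" where
  "angle_box N = {..<N} \<rightarrow>\<^sub>E {0..2 * pi}"

definition angle_lebesgue :: "nat \<Rightarrow> (nat \<Rightarrow> real) measure" where
  "angle_lebesgue N = (\<Pi>\<^sub>M i\<in>{..<N}. lborel)"

text \<open>
  The integral defining the logarithmic Mahler measure is the Lebesgue integral over the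
  N-dimensional box. The Bochner integral of a non-integrable function is 0 by convention, so
  existence of the integral is a separate predicate. The convention \<open>ln 0 = 0\<close> is relevant
  only on the zero set of P.
\<close>

definition log_mahler_defined :: "nat \<Rightarrow> ((nat \<Rightarrow> complex) \<Rightarrow> complex) \<Rightarrow> bool" where
  "log_mahler_defined N P \<longleftrightarrow>
     set_integrable (angle_lebesgue N) (angle_box N) (\<lambda>\<theta>. ln (cmod (P (torus_point \<theta>))))"

definition log_mahler :: "nat \<Rightarrow> ((nat \<Rightarrow> complex) \<Rightarrow> complex) \<Rightarrow> real" where
  "log_mahler N P =
     1 / (2 * pi) ^ N *
     set_lebesgue_integral (angle_lebesgue N) (angle_box N)
       (\<lambda>\<theta>. ln (cmod (P (torus_point \<theta>))))"

text \<open>A vector \<open>(W\<^sub>0, \<dots>, W\<^sub>n)\<close> is a function on \<open>nat\<close>, used only at the indices \<open>0, \<dots>, n\<close>.\<close>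

definition linear_form :: "nat \<Rightarrow> (nat \<Rightarrow> complex) \<Rightarrow> (nat \<Rightarrow> complex) \<Rightarrow> complex" where
  "linear_form n W = (\<lambda>Z. \<Sum>m\<le>n. W m * Z m)"

definition sq_norm_vec :: "nat \<Rightarrow> (nat \<Rightarrow> complex) \<Rightarrow> real" where
  "sq_norm_vec n W = (\<Sum>m\<le>n. (cmod (W m))\<^sup>2)"

definition compositions :: "nat \<Rightarrow> nat \<Rightarrow> (nat \<Rightarrow> nat) set" where
  "compositions n k = {l \<in> {..n} \<rightarrow>\<^sub>E UNIV. (\<Sum>m\<le>n. l m) = k}"

definition multinom :: "nat \<Rightarrow> nat \<Rightarrow> (nat \<Rightarrow> nat) \<Rightarrow> real" where
  "multinom n k l = fact k / (\<Prod>m\<le>n. fact (l m))"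

definition a_coeff :: "nat \<Rightarrow> nat \<Rightarrow> (nat \<Rightarrow> complex) \<Rightarrow> real" where
  "a_coeff n k W =
     (\<Sum>l\<in>compositions n k. (multinom n k l)\<^sup>2 * (\<Prod>m\<le>n. cmod (W m) ^ (2 * l m)))"

text \<open>For finite \<open>{..n}\<close> the index set of \<open>a_coeff\<close> is finite, so the sum is not degenerate.\<close>

lemma finite_compositions: "finite (compositions n k)"
proof (rule finite_subset)
  show "compositions n k \<subseteq> {..n} \<rightarrow>\<^sub>E {..k}"
  proof
    fix l assume "l \<in> compositions n k"
    then have l: "l \<in> {..n} \<rightarrow>\<^sub>E UNIV" and s: "(\<Sum>m\<le>n. l m) = k"
      by (auto simp: compositions_def)
    have "l m \<le> k" if "m \<le> n" for m
      using member_le_sum[of m "{..n}" l] that s by simp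
    with l show "l \<in> {..n} \<rightarrow>\<^sub>E {..k}"
      by (auto simp: PiE_def)
  qed
  show "finite ({..n} \<rightarrow>\<^sub>E {..k})"
    by (intro finite_PiE) auto
qed

end

(*
  Let X = |P_D|^2 / c(D)^2 on the torus with its normalised measure. By Cauchy-Schwarz
  0 <= X <= 1, and the k-th moment of X is a(n,k,D) / c(D)^(2k): integrating out one angle at a
  time, Parseval's identity on the circle yields a recursion in n which a(n,k,D) satisfies too.
  Hence the j-th summand is E[(1 - X)^j] / j, and the series is E[-ln X], by dominated
  convergence with majorant -ln X. Integrability of ln X holds because |P_D| < s has probability
  O(s): with all angles but one fixed, w e^(i theta) lies within s of a given point only for
  theta in boundedly many intervals of length O(s).
*)

theory Submission
  imports Defs
begin

section \<open>Small values on a circle and integrability of a logarithm\<close>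

text \<open>The Taylor remainder of sine is at most \<open>\<bar>x\<bar> ^ 3 / 6\<close>. Since pi /
  2 < 1.6 and 1.6^2 < 3, it is at most half of \<open>\<bar>x\<bar>\<close>, which leaves the other
  half for the sine.\<close>

lemma abs_le_two_abs_sin:
  fixes x :: real
  assumes "\<bar>x\<bar> \<le> pi / 2"
  shows "\<bar>x\<bar> \<le> 2 * \<bar>sin x\<bar>"
proof -
  have "\<bar>sin x - (\<Sum>m<3. sin_coeff m * x ^ m)\<bar> \<le> inverse (fact 3) * \<bar>x\<bar> ^ 3"
    by (rule Maclaurin_sin_bound)
  then have *: "\<bar>sin x - x\<bar> \<le> \<bar>x\<bar> * (\<bar>x\<bar>\<^sup>2 / 6)"
    by (simp add: sin_coeff_def eval_nat_numeral field_simps)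
  have "\<bar>x\<bar> \<le> 1.6"
    using assms pi_approx by simp
  then have "\<bar>x\<bar>\<^sup>2 \<le> 1.6\<^sup>2"
    by (intro power_mono) auto
  then have "\<bar>x\<bar> * (\<bar>x\<bar>\<^sup>2 / 6) \<le> \<bar>x\<bar> * (1 / 2)"
    by (intro mult_left_mono) (auto simp: power2_eq_square)
  with * show ?thesis by linarith
qed

text \<open>The zeros of sine in [-pi, pi] are -pi, 0 and pi. Translating by the nearest one changes
  the sine at most in sign and brings the argument into the range of
  \<open>abs_le_two_abs_sin\<close>.\<close>

lemma abs_sub_pi_multiple_le:
  fixes y :: real
  assumes "\<bar>y\<bar> \<le> pi"
  shows "\<exists>k\<in>{-1, 0, 1::int}. \<bar>y - of_int k * pi\<bar> \<le> 2 * \<bar>sin y\<bar>"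
proof -
  consider "\<bar>y\<bar> \<le> pi / 2" | "y > pi / 2" | "y < - (pi / 2)" by linarith
  then show ?thesis
  proof cases
    case 1
    then show ?thesis using abs_le_two_abs_sin[of y] by auto
  next
    case 2
    then show ?thesis using abs_le_two_abs_sin[of "y - pi"] assms by auto
  next
    case 3
    then show ?thesis using abs_le_two_abs_sin[of "y + pi"] assms by auto
  qed
qed

text \<open>Two angles in the set differ, modulo \<open>2 * pi\<close>, by at most \<open>4 * s / cmod w\<close>.\<close>

lemma emeasure_small_circle_value:
  fixes b w :: complex and s :: real
  assumes "w \<noteq> 0" "s > 0"
  shows "emeasure lborel {\<theta> \<in> {0..2 * pi}. cmod (b + w * exp (\<i> * of_real \<theta>)) < s}
    \<le> ennreal (24 / cmod w * s)"
proof (cases "{\<theta> \<in> {0..2 * pi}. cmod (b + w * exp (\<i> * of_real \<theta>)) < s} = {}")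
  case True
  then show ?thesis by (simp only: emeasure_empty zero_le)
next
  case False
  then obtain \<phi> where \<phi>: "\<phi> \<in> {0..2 * pi}" "cmod (b + w * exp (\<i> * of_real \<phi>)) < s" by auto
  \<comment> \<open>Two points of the set have values less than 2 * s apart, so the sine of half the
    angle difference is below s / \<open>cmod w\<close>. The factor 2 of the sine bound and the
    undoing of the halving give \<open>d\<close>. Three intervals of length 2 * \<open>d\<close>
    then account for the constant 24.\<close>
  define d where "d = 4 * s / cmod w"
  define J where "J k = {\<phi> + of_int k * (2 * pi) - d .. \<phi> + of_int k * (2 * pi) + d}" for k :: int
  have d: "d > 0" using assms by (simp add: d_def)
  have "\<theta> \<in> J (-1) \<union> J 0 \<union> J 1"
    if \<theta>: "\<theta> \<in> {0..2 * pi}" "cmod (b + w * exp (\<i> * of_real \<theta>)) < s" for \<theta>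
  proof -
    have "cmod w * cmod (exp (\<i> * of_real \<theta>) - exp (\<i> * of_real \<phi>)) =
        cmod ((b + w * exp (\<i> * of_real \<theta>)) - (b + w * exp (\<i> * of_real \<phi>)))"
      by (simp add: norm_mult[symmetric] algebra_simps)
    also have "\<dots> < 2 * s"
      using norm_triangle_ineq4[of "b + w * exp (\<i> * of_real \<theta>)" "b + w * exp (\<i> * of_real \<phi>)"]
        \<theta> \<phi> by linarith
    finally have "cmod w * cmod (exp (\<i> * of_real \<theta>) - exp (\<i> * of_real \<phi>)) < 2 * s" .
    moreover have "exp (\<i> * of_real \<theta>) - exp (\<i> * of_real \<phi>) =
        exp (\<i> * of_real \<phi>) * (exp (\<i> * of_real (\<theta> - \<phi>)) - 1)"
      by (simp add: algebra_simps flip: exp_add)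
    ultimately have "cmod w * (2 * \<bar>sin ((\<theta> - \<phi>) / 2)\<bar>) < 2 * s"
      by (simp only: norm_mult norm_exp_i_times dist_exp_i_1 mult_1)
    then have sin: "4 * \<bar>sin ((\<theta> - \<phi>) / 2)\<bar> < d"
      using assms by (simp add: d_def field_simps)
    have "\<bar>(\<theta> - \<phi>) / 2\<bar> \<le> pi"
      using \<theta>(1) \<phi>(1) by (auto simp: abs_le_iff)
    then obtain k where k: "k \<in> {-1, 0, 1::int}"
      "\<bar>(\<theta> - \<phi>) / 2 - of_int k * pi\<bar> \<le> 2 * \<bar>sin ((\<theta> - \<phi>) / 2)\<bar>"
      using abs_sub_pi_multiple_le by blast
    have "\<theta> \<in> J k"
      using k(2) sin by (auto simp: J_def abs_le_iff field_simps)
    with k(1) show ?thesis by auto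
  qed
  then have "{\<theta> \<in> {0..2 * pi}. cmod (b + w * exp (\<i> * of_real \<theta>)) < s} \<subseteq> J (-1) \<union> J 0 \<union> J 1"
    by blast
  then have "emeasure lborel {\<theta> \<in> {0..2 * pi}. cmod (b + w * exp (\<i> * of_real \<theta>)) < s}
      \<le> emeasure lborel (J (-1) \<union> J 0 \<union> J 1)"
    by (intro emeasure_mono) (auto simp: J_def)
  also have "\<dots> \<le> emeasure lborel (J (-1)) + emeasure lborel (J 0) + emeasure lborel (J 1)"
    by (intro order_trans[OF emeasure_subadditive] add_mono emeasure_subadditive) (auto simp: J_def)
  also have "\<dots> = ennreal (6 * d)"
    using d by (simp add: J_def flip: ennreal_plus)
  finally show ?thesis by (simp add: d_def)
qed

text \<open>If \<open>0 < Y < 1\<close>, then \<open>- ln Y\<close> is at most the number of \<open>j\<close> with \<open>Y < exp (- j)\<close>.\<close>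

lemma integrable_ln_of_linear_tail:
  fixes Y :: "'a \<Rightarrow> real"
  assumes "finite_measure M" and [measurable]: "Y \<in> borel_measurable M"
    and bound: "\<And>x. x \<in> space M \<Longrightarrow> 0 \<le> Y x \<and> Y x \<le> K"
    and tail: "\<And>s. s > 0 \<Longrightarrow> emeasure M {x \<in> space M. Y x < s} \<le> ennreal (C * s)"
    and C: "C \<ge> 0"
  shows "(AE x in M. Y x > 0) \<and> integrable M (\<lambda>x. ln (Y x))"
proof
  interpret finite_measure M by fact
  have le: "emeasure M {x \<in> space M. Y x \<le> 0} \<le> ennreal (C * e)" if "e > 0" for e :: real
    by (rule order_trans[OF emeasure_mono tail[OF that]]) (use that in auto)
  \<comment> \<open>The zero set lies in every sublevel set, so its measure is arbitrarily small.
    Dividing by C + 1 instead of C covers C = 0.\<close>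
  have "emeasure M {x \<in> space M. Y x \<le> 0} \<le> 0"
  proof (rule ennreal_le_epsilon)
    fix e :: real assume "e > 0"
    then have "C * (e / (C + 1)) \<le> e"
      using C by (simp add: field_simps)
    then show "emeasure M {x \<in> space M. Y x \<le> 0} \<le> 0 + ennreal e"
      using le[of "e / (C + 1)"] C \<open>e > 0\<close> ennreal_leI order_trans by fastforce
  qed
  then have "{x \<in> space M. Y x \<le> 0} \<in> null_sets M"
    by (intro null_setsI) auto
  then show "AE x in M. Y x > 0"
    by (rule AE_I') auto
  let ?A = "\<lambda>j::nat. {x \<in> space M. Y x < exp (- real j)}"
  \<comment> \<open>The convention \<open>ln 0 = 0\<close> settles \<open>Y x = 0\<close>. The
    constant term serves the points with \<open>Y x \<ge> 1\<close>, by ln y \<le> y - 1; the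
    counting sum serves the rest.\<close>
  have pw: "ennreal (norm (ln (Y x))) \<le> ennreal \<bar>K\<bar> + (\<Sum>j. indicator (?A j) x)"
    if x: "x \<in> space M" for x
  proof -
    consider "Y x = 0" | "Y x \<ge> 1" | "0 < Y x" "Y x < 1" using bound[OF x] by linarith
    then show ?thesis
    proof cases
      case 2
      then have "\<bar>ln (Y x)\<bar> \<le> \<bar>K\<bar>"
        using bound[OF x] ln_le_minus_one[of "Y x"] by simp
      then show ?thesis
        by (simp add: add_increasing2 ennreal_leI)
    next
      case 3
      define J where "J = nat \<lceil>- ln (Y x)\<rceil>"
      have "x \<in> ?A j" if "j < J" for j
      proof -
        have "real j < - ln (Y x)" using that by (simp add: J_def) linarith
        then have "ln (Y x) < - real j" by simp
        then have "exp (ln (Y x)) < exp (- real j)" by (subst exp_less_cancel_iff)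
        with 3 x show ?thesis by simp
      qed
      then have "(\<Sum>j<J. indicator (?A j) x) = (of_nat J :: ennreal)" by simp
      moreover have "ennreal (norm (ln (Y x))) \<le> of_nat J"
        using 3 by (simp add: J_def ennreal_of_nat_eq_real_of_nat ennreal_leI)
      moreover have "(\<Sum>j<J. indicator (?A j) x) \<le> (\<Sum>j. indicator (?A j) x :: ennreal)"
        by (rule sum_le_suminf) auto
      ultimately have "ennreal (norm (ln (Y x))) \<le> (\<Sum>j. indicator (?A j) x)"
        by (simp only: order_trans)
      then show ?thesis
        by (rule add_increasing[OF zero_le])
    qed simp
  qed
  \<comment> \<open>At level \<open>exp (- j)\<close> the tail hypothesis bounds the j-th measure by
    a term of a geometric series.\<close>
  have exp_sums: "summable (\<lambda>j. C * exp (- real j))"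
  proof -
    have "(\<lambda>j. C * exp (- real j)) = (\<lambda>j. C * exp (-1) ^ j)"
      by (simp flip: exp_of_nat_mult)
    then show ?thesis by (simp add: summable_geometric)
  qed
  have "(\<integral>\<^sup>+x. ennreal (norm (ln (Y x))) \<partial>M)
      \<le> (\<integral>\<^sup>+x. ennreal \<bar>K\<bar> + (\<Sum>j. indicator (?A j) x) \<partial>M)"
    by (intro nn_integral_mono pw)
  also have "\<dots> = ennreal \<bar>K\<bar> * emeasure M (space M) + (\<Sum>j. emeasure M (?A j))"
    by (subst nn_integral_add) (simp_all add: nn_integral_suminf)
  also have "\<dots> \<le> ennreal \<bar>K\<bar> * emeasure M (space M) + (\<Sum>j. ennreal (C * exp (- real j)))"
    by (intro add_left_mono suminf_le tail) auto
  also have "\<dots> < \<infinity>"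
    using C by (simp add: suminf_ennreal2[OF _ exp_sums] emeasure_eq_measure ennreal_mult_less_top)
  finally show "integrable M (\<lambda>x. ln (Y x))"
    by (intro integrableI_bounded) auto
qed

section \<open>Iterated integration over the box of angles\<close>

text \<open>Values in \<open>ennreal\<close> allow Tonelli without integrability conditions. The
  index set is arbitrary so that any single angle can be split off. The measure is not normalised,
  hence the powers of 2 * pi below.\<close>

definition torus_integral :: "nat set \<Rightarrow> ((nat \<Rightarrow> real) \<Rightarrow> ennreal) \<Rightarrow> ennreal" where
  "torus_integral I f = (\<integral>\<^sup>+\<theta>\<in>(I \<rightarrow>\<^sub>E {0..2 * pi}). f \<theta> \<partial>(\<Pi>\<^sub>M i\<in>I. lborel))"

lemma sets_angle_PiE:
  "finite I \<Longrightarrow> (I \<rightarrow>\<^sub>E {0..2 * pi}) \<in> sets (\<Pi>\<^sub>M i\<in>I. (lborel :: real measure))"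
  by (rule sets_PiM_I_finite) auto

text \<open>This is Tonelli with angle \<open>i\<close> innermost: the indicator of the box factors
  into the indicator of the smaller box and that of the interval for \<open>i\<close>.\<close>

lemma torus_integral_insert:
  assumes "finite I" "i \<notin> I"
    and f[measurable]: "f \<in> borel_measurable (\<Pi>\<^sub>M i\<in>insert i I. lborel)"
  shows "torus_integral (insert i I) f =
    torus_integral I (\<lambda>x. \<integral>\<^sup>+y\<in>{0..2 * pi}. f (x(i := y)) \<partial>lborel)"
proof -
  interpret product_sigma_finite "\<lambda>_. lborel :: real measure" by standard
  have [measurable]: "(insert i I \<rightarrow>\<^sub>E {0..2 * pi}) \<in> sets (\<Pi>\<^sub>M i\<in>insert i I. (lborel :: real measure))"
    using assms by (intro sets_angle_PiE) auto
  have *: "(\<integral>\<^sup>+y. f (x(i := y)) * indicator (insert i I \<rightarrow>\<^sub>E {0..2 * pi}) (x(i := y)) \<partial>lborel)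
      = (\<integral>\<^sup>+y\<in>{0..2 * pi}. f (x(i := y)) \<partial>lborel) * indicator (I \<rightarrow>\<^sub>E {0..2 * pi}) x"
    if "x \<in> space (\<Pi>\<^sub>M i\<in>I. (lborel :: real measure))" for x
  proof -
    have ind: "x(i := y) \<in> (insert i I \<rightarrow>\<^sub>E {0..2 * pi}) \<longleftrightarrow>
        x \<in> (I \<rightarrow>\<^sub>E {0..2 * pi}) \<and> y \<in> {0..2 * pi}" for y
      using that assms(2) by (auto simp: space_PiM PiE_iff extensional_def split: if_split_asm)
    show ?thesis
      by (cases "x \<in> (I \<rightarrow>\<^sub>E {0..2 * pi})") (auto simp: ind indicator_def intro!: nn_integral_cong)
  qed
  show ?thesis
    unfolding torus_integral_def
    by (subst product_nn_integral_insert) (use assms(1,2) in \<open>auto intro!: nn_integral_cong * simp del: fun_upd_apply\<close>)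
qed

lemma torus_integral_empty: "torus_integral {} f = f (\<lambda>_. undefined)"
  by (simp add: torus_integral_def nn_integral_empty PiM_empty nn_integral_count_space_finite)

lemma torus_integral_const:
  assumes "finite I"
  shows "torus_integral I (\<lambda>_. ennreal C) = ennreal C * ennreal ((2 * pi) ^ card I)"
  using assms
proof (induction I)
  case empty
  then show ?case by (simp add: torus_integral_empty)
next
  case (insert i I)
  then have "torus_integral (insert i I) (\<lambda>_. ennreal C) =
      torus_integral I (\<lambda>_. ennreal C * ennreal (2 * pi))"
    by (subst torus_integral_insert) (auto simp: nn_integral_cmult)
  also have "\<dots> = ennreal (2 * pi) * torus_integral I (\<lambda>_. ennreal C)"
    unfolding torus_integral_def using sets_angle_PiE[OF insert(1)]
    by (subst nn_integral_cmult[symmetric]) (auto simp: ac_simps)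
  finally show ?case
    using insert by (simp add: ennreal_mult' ac_simps)
qed

section \<open>Orthogonality and moments on the circle\<close>

text \<open>For non-zero \<open>m\<close> the primitive \<open>F\<close> is 2 * pi periodic along
  the reals, so its values at the two endpoints cancel.\<close>

lemma has_integral_exp_int:
  "((\<lambda>\<theta>. exp (\<i> * of_int m * of_real \<theta>)) has_integral (if m = 0 then of_real (2 * pi) else 0)) {0..2 * pi}"
proof (cases "m = 0")
  case True
  then show ?thesis
    using has_integral_const_real[of "1::complex" 0 "2 * pi"] by (simp add: scaleR_conv_of_real)
next
  case False
  define F where "F = (\<lambda>z. exp (\<i> * of_int m * z) / (\<i> * of_int m))"
  have "((\<lambda>\<theta>. exp (\<i> * of_int m * of_real \<theta>)) has_integral
      (F (of_real (2 * pi)) - F (of_real 0))) {0..2 * pi}"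
  proof (rule fundamental_theorem_of_calculus)
    fix x :: real
    have "(F has_field_derivative exp (\<i> * of_int m * of_real x)) (at (of_real x))"
      unfolding F_def using False by (auto intro!: derivative_eq_intros)
    then show "((\<lambda>x. F (of_real x)) has_vector_derivative exp (\<i> * of_int m * of_real x))
        (at x within {0..2 * pi})"
      by (rule has_vector_derivative_real_field)
  qed simp
  moreover have "exp (\<i> * of_int m * of_real (2 * pi)) = 1"
    using exp_integer_2pi[of "of_int m"] by (simp add: ac_simps)
  then have "F (of_real (2 * pi)) = F (of_real 0)"
    by (simp add: F_def)
  ultimately show ?thesis using False by simp
qed

text \<open>Writing the squared modulus as z times its conjugate gives a double sum of characters
  with frequencies j - l. By orthogonality only the diagonal survives. The computation is complex,
  and the real part is taken at the end.\<close>

lemma parseval_trig_poly: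
  fixes c :: "nat \<Rightarrow> complex"
  shows "((\<lambda>\<theta>. (cmod (\<Sum>j\<le>k. c j * exp (\<i> * of_real \<theta>) ^ j))\<^sup>2) has_integral
    2 * pi * (\<Sum>j\<le>k. (cmod (c j))\<^sup>2)) {0..2 * pi}"
proof -
  have norm_sq: "(complex_of_real (cmod z))\<^sup>2 = z * cnj z" for z
    using complex_norm_square[of z] by simp
  have "((\<lambda>\<theta>. \<Sum>j\<le>k. \<Sum>l\<le>k. c j * cnj (c l) * exp (\<i> * of_int (int j - int l) * of_real \<theta>))
      has_integral (\<Sum>j\<le>k. \<Sum>l\<le>k. c j * cnj (c l) *
        (if int j - int l = 0 then of_real (2 * pi) else 0))) {0..2 * pi}"
    by (intro has_integral_sum has_integral_mult_right has_integral_exp_int) auto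
  moreover have "(\<Sum>j\<le>k. \<Sum>l\<le>k. c j * cnj (c l) *
        (if int j - int l = 0 then of_real (2 * pi) else 0)) =
      of_real (2 * pi * (\<Sum>j\<le>k. (cmod (c j))\<^sup>2))"
    by (simp add: norm_sq sum_distrib_left if_distrib sum.delta ac_simps cong: if_cong)
  moreover have "(\<Sum>j\<le>k. \<Sum>l\<le>k. c j * cnj (c l) * exp (\<i> * of_int (int j - int l) * of_real \<theta>)) =
      of_real ((cmod (\<Sum>j\<le>k. c j * exp (\<i> * of_real \<theta>) ^ j))\<^sup>2)" for \<theta>
  proof -
    have "exp (\<i> * of_int (int j - int l) * of_real \<theta>) =
        exp (\<i> * of_real \<theta>) ^ j * cnj (exp (\<i> * of_real \<theta>) ^ l)" for j l
      by (simp add: exp_cnj algebra_simps flip: exp_of_nat_mult exp_add)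
    then show ?thesis
      by (simp add: norm_sq sum_product ac_simps)
  qed
  ultimately have "((\<lambda>\<theta>. complex_of_real ((cmod (\<Sum>j\<le>k. c j * exp (\<i> * of_real \<theta>) ^ j))\<^sup>2)) has_integral
      of_real (2 * pi * (\<Sum>j\<le>k. (cmod (c j))\<^sup>2))) {0..2 * pi}"
    by simp
  from has_integral_linear[OF this bounded_linear_Re] show ?thesis
    by (simp add: o_def)
qed

text \<open>The k-th power of b + w e^(i theta) is, by the binomial theorem, a trigonometric
  polynomial with coefficients (k choose j) w^j b^(k-j); Parseval applies to it.\<close>

lemma circle_moment:
  fixes b w :: complex
  shows "(\<integral>\<^sup>+\<theta>\<in>{0..2 * pi}. ennreal (cmod (b + w * exp (\<i> * of_real \<theta>)) ^ (2 * k)) \<partial>lborel) =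
    ennreal (2 * pi * (\<Sum>j\<le>k. (real (k choose j))\<^sup>2 * cmod w ^ (2 * j) * cmod b ^ (2 * (k - j))))"
proof -
  have "cmod (b + w * exp (\<i> * of_real \<theta>)) ^ (2 * k) =
      (cmod (\<Sum>j\<le>k. (of_nat (k choose j) * w ^ j * b ^ (k - j)) * exp (\<i> * of_real \<theta>) ^ j))\<^sup>2" for \<theta>
  proof -
    have "(w * exp (\<i> * of_real \<theta>) + b) ^ k =
        (\<Sum>j\<le>k. (of_nat (k choose j) * w ^ j * b ^ (k - j)) * exp (\<i> * of_real \<theta>) ^ j)"
      unfolding binomial_ring by (simp add: power_mult_distrib ac_simps)
    then show ?thesis
      by (simp add: power_mult[of _ k 2] norm_power mult.commute[of 2] add.commute[of b]
        flip: norm_power)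
  qed
  then show ?thesis
    using nn_integral_has_integral_lebesgue'[OF _ parseval_trig_poly[of
      "\<lambda>j. of_nat (k choose j) * w ^ j * b ^ (k - j)" k]]
    by (simp add: norm_mult norm_power power_mult_distrib power_mult[symmetric] ac_simps)
qed

section \<open>Moments of the linear form on the torus\<close>

lemma measurable_linear_form[measurable]:
  assumes "{..n} \<subseteq> I"
  shows "(\<lambda>\<theta>. linear_form n W (torus_point \<theta>)) \<in> borel_measurable (\<Pi>\<^sub>M i\<in>I. lborel)"
proof -
  have "(\<lambda>\<theta>. \<theta> m) \<in> borel_measurable (\<Pi>\<^sub>M i\<in>I. lborel)" if "m \<in> {..n}" for m
    using measurable_component_singleton[of m I "\<lambda>_. lborel :: real measure"] that assms by auto
  then show ?thesis
    unfolding linear_form_def torus_point_def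
    by (intro borel_measurable_sum borel_measurable_times borel_measurable_const
      borel_measurable_continuous_on[where f="\<lambda>x. exp (\<i> * complex_of_real x)"] continuous_intros) auto
qed

lemma multinom_fun_upd:
  assumes "j \<le> k"
  shows "multinom (Suc n) k (l(Suc n := j)) = real (k choose j) * multinom n (k - j) l"
proof -
  have "(\<Prod>m\<le>n. fact ((l(Suc n := j)) m)) = (\<Prod>m\<le>n. fact (l m) :: real)"
    by (intro prod.cong) auto
  then show ?thesis
    using assms by (simp add: multinom_def binomial_fact)
qed

text \<open>A composition of \<open>k\<close> is its last part j together with a composition of k -
  j, and the multinomial coefficient factors accordingly. The result has the shape of
  \<open>circle_moment\<close>, with the powers of \<open>cmod b\<close> replaced by lower
  coefficients.\<close>

lemma a_coeff_Suc:
  "a_coeff (Suc n) k W =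
    (\<Sum>j\<le>k. (real (k choose j))\<^sup>2 * cmod (W (Suc n)) ^ (2 * j) * a_coeff n (k - j) W)"
proof -
  let ?g = "\<lambda>n k l. (multinom n k l)\<^sup>2 * (\<Prod>m\<le>n. cmod (W m) ^ (2 * l m))"
  let ?S = "Sigma {..k} (\<lambda>j. compositions n (k - j))"
  have upd: "l(Suc n := j) \<in> compositions (Suc n) k"
    if "j \<le> k" "l \<in> compositions n (k - j)" for j l
  proof -
    have "(\<Sum>m\<le>n. (l(Suc n := j)) m) = (\<Sum>m\<le>n. l m)"
      by (intro sum.cong) auto
    with that show ?thesis
      by (auto simp: compositions_def PiE_iff extensional_def)
  qed
  \<comment> \<open>Compositions are \<open>undefined\<close> outside their index range, so
    restricting and updating at \<open>Suc n\<close> are inverse to each other.\<close>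
  have restr: "restrict l {..n} \<in> compositions n (k - l (Suc n)) \<and> l (Suc n) \<le> k \<and>
      (restrict l {..n})(Suc n := l (Suc n)) = l" if "l \<in> compositions (Suc n) k" for l
    using that by (auto simp: compositions_def PiE_iff extensional_def fun_eq_iff le_Suc_eq)
  have res: "restrict (l(Suc n := j)) {..n} = l" if "l \<in> compositions n i" for l i j
    using that by (auto simp: compositions_def PiE_iff extensional_def fun_eq_iff)
  have "a_coeff (Suc n) k W = (\<Sum>(j, l)\<in>?S. ?g (Suc n) k (l(Suc n := j)))"
    unfolding a_coeff_def
    by (rule sum.reindex_bij_witness[where i = "\<lambda>(j, l). l(Suc n := j)"
          and j = "\<lambda>l. (l (Suc n), restrict l {..n})"])
      (use upd restr res in \<open>auto simp del: fun_upd_apply, auto\<close>)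
  also have "\<dots> = (\<Sum>j\<le>k. \<Sum>l\<in>compositions n (k - j). ?g (Suc n) k (l(Suc n := j)))"
    by (subst sum.Sigma) (auto simp: finite_compositions)
  also have "\<dots> = (\<Sum>j\<le>k. \<Sum>l\<in>compositions n (k - j).
      (real (k choose j))\<^sup>2 * cmod (W (Suc n)) ^ (2 * j) * ?g n (k - j) l)"
  proof (intro sum.cong refl)
    fix j l assume "j \<in> {..k}"
    have "(\<Prod>m\<le>n. cmod (W m) ^ (2 * (l(Suc n := j)) m)) = (\<Prod>m\<le>n. cmod (W m) ^ (2 * l m))"
      by (intro prod.cong) auto
    with \<open>j \<in> {..k}\<close> show "?g (Suc n) k (l(Suc n := j)) =
        (real (k choose j))\<^sup>2 * cmod (W (Suc n)) ^ (2 * j) * ?g n (k - j) l"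
      by (simp add: multinom_fun_upd power_mult_distrib ac_simps)
  qed
  finally show ?thesis
    by (simp add: a_coeff_def sum_distrib_left)
qed

lemma a_coeff_0: "a_coeff 0 k W = cmod (W 0) ^ (2 * k)"
proof -
  have "compositions 0 k = {\<lambda>m. if m = 0 then k else undefined}"
    by (auto simp: compositions_def PiE_iff extensional_def fun_eq_iff)
  then show ?thesis
    by (simp add: a_coeff_def multinom_def)
qed

lemma a_coeff_nonneg: "a_coeff n k W \<ge> 0"
  by (auto simp: a_coeff_def intro!: sum_nonneg mult_nonneg_nonneg prod_nonneg)

lemma linear_form_fun_upd:
  "linear_form (Suc n) W (torus_point (x(Suc n := y))) =
    linear_form n W (torus_point x) + W (Suc n) * exp (\<i> * of_real y)"
  by (auto simp: linear_form_def torus_point_def intro!: sum.cong)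

text \<open>The induction leaves \<open>k\<close> arbitrary because integrating out the last angle
  produces all moments of order at most \<open>k\<close> of the shorter form.\<close>

lemma torus_moment:
  "torus_integral {..n} (\<lambda>\<theta>. ennreal (cmod (linear_form n W (torus_point \<theta>)) ^ (2 * k))) =
    ennreal ((2 * pi) ^ (n + 1) * a_coeff n k W)"
proof (induction n arbitrary: k)
  case 0
  have [measurable]: "(\<lambda>\<theta>. linear_form 0 W (torus_point \<theta>)) \<in> borel_measurable (\<Pi>\<^sub>M i\<in>{0}. lborel)"
    by (intro measurable_linear_form) auto
  have "torus_integral {..0} (\<lambda>\<theta>. ennreal (cmod (linear_form 0 W (torus_point \<theta>)) ^ (2 * k))) =
      (\<integral>\<^sup>+y\<in>{0..2 * pi}. ennreal (cmod (W 0) ^ (2 * k)) \<partial>lborel)"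
    by (simp add: torus_integral_insert torus_integral_empty)
      (simp add: linear_form_def torus_point_def norm_mult)
  also have "\<dots> = ennreal (cmod (W 0) ^ (2 * k)) * ennreal (2 * pi)"
    by (subst nn_integral_cmult_indicator) auto
  finally show ?case
    by (simp add: a_coeff_0 mult.commute flip: ennreal_mult')
next
  case (Suc n)
  let ?P = "\<lambda>x. cmod (linear_form n W (torus_point x))"
  let ?c = "\<lambda>j. 2 * pi * ((real (k choose j))\<^sup>2 * cmod (W (Suc n)) ^ (2 * j))"
  have [measurable]: "(\<lambda>\<theta>. linear_form n W (torus_point \<theta>)) \<in> borel_measurable (\<Pi>\<^sub>M i\<in>{..n}. lborel)"
    "(\<lambda>\<theta>. linear_form (Suc n) W (torus_point \<theta>)) \<in> borel_measurable (\<Pi>\<^sub>M i\<in>insert (Suc n) {..n}. lborel)"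
    by (intro measurable_linear_form; auto)+
  have [measurable]: "({..n} \<rightarrow>\<^sub>E {0..2 * pi}) \<in> sets (\<Pi>\<^sub>M i\<in>{..n}. (lborel :: real measure))"
    by (rule sets_angle_PiE) simp
  have "torus_integral {..Suc n} (\<lambda>\<theta>. ennreal (cmod (linear_form (Suc n) W (torus_point \<theta>)) ^ (2 * k))) =
      torus_integral {..n} (\<lambda>x. \<integral>\<^sup>+y\<in>{0..2 * pi}.
        ennreal (cmod (linear_form n W (torus_point x) + W (Suc n) * exp (\<i> * of_real y)) ^ (2 * k)) \<partial>lborel)"
    unfolding atMost_Suc by (subst torus_integral_insert) (auto simp: linear_form_fun_upd simp del: fun_upd_apply)
  \<comment> \<open>Here \<open>circle_moment\<close> is applied with \<open>b\<close> the value of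
    the shorter form, which does not depend on the last angle.\<close>
  also have "\<dots> = torus_integral {..n} (\<lambda>x. \<Sum>j\<le>k. ennreal (?c j) * ennreal (?P x ^ (2 * (k - j))))"
    unfolding circle_moment
    by (simp add: sum_distrib_left sum_nonneg mult.assoc flip: ennreal_mult')
  also have "\<dots> = (\<Sum>j\<le>k. ennreal (?c j) * torus_integral {..n} (\<lambda>x. ennreal (?P x ^ (2 * (k - j)))))"
    unfolding torus_integral_def
    by (simp add: sum_distrib_right mult.assoc nn_integral_sum nn_integral_cmult)
  also have "\<dots> = (\<Sum>j\<le>k. ennreal (?c j * ((2 * pi) ^ (n + 1) * a_coeff n (k - j) W)))"
    unfolding Suc.IH by (simp flip: ennreal_mult')
  also have "\<dots> = ennreal (\<Sum>j\<le>k. ?c j * ((2 * pi) ^ (n + 1) * a_coeff n (k - j) W))"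
    by (intro sum_ennreal) (simp add: a_coeff_nonneg)
  also have "(\<Sum>j\<le>k. ?c j * ((2 * pi) ^ (n + 1) * a_coeff n (k - j) W)) =
      (2 * pi) ^ (Suc n + 1) * a_coeff (Suc n) k W"
    by (simp add: a_coeff_Suc sum_distrib_left ac_simps)
  finally show ?case .
qed

section \<open>Small values and the upper bound of the linear form\<close>

text \<open>The angle of a non-zero coefficient is integrated first. The circle estimate is uniform
  in the contribution \<open>b\<close> of the other angles, whose box has volume (2 * pi)^n.\<close>

lemma torus_small_value:
  assumes "m \<le> n" "W m \<noteq> 0" "s > 0"
  shows "torus_integral {..n} (indicator {\<theta>. cmod (linear_form n W (torus_point \<theta>)) < s})
    \<le> ennreal (24 * (2 * pi) ^ n / cmod (W m) * s)"
proof -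
  let ?I = "{..n} - {m}"
  let ?A = "{\<theta>. cmod (linear_form n W (torus_point \<theta>)) < s}"
  let ?b = "\<lambda>x. \<Sum>i\<in>?I. W i * torus_point x i"
  have I: "insert m ?I = {..n}" using assms by auto
  \<comment> \<open>The non-zero coefficient may sit at any index, so the split is made at
    \<open>m\<close> and not at the last variable.\<close>
  have lf: "linear_form n W (torus_point (x(m := y))) = ?b x + W m * exp (\<i> * of_real y)" for x y
  proof -
    have "linear_form n W (torus_point (x(m := y))) =
        W m * torus_point (x(m := y)) m + (\<Sum>i\<in>?I. W i * torus_point (x(m := y)) i)"
      unfolding linear_form_def using assms by (intro sum.remove) auto
    also have "(\<Sum>i\<in>?I. W i * torus_point (x(m := y)) i) = ?b x"
      by (intro sum.cong) (auto simp: torus_point_def)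
    finally show ?thesis by (simp add: torus_point_def)
  qed
  have [measurable]: "(\<lambda>\<theta>. linear_form n W (torus_point \<theta>)) \<in> borel_measurable (\<Pi>\<^sub>M i\<in>insert m ?I. lborel)"
    by (intro measurable_linear_form) auto
  have "{\<theta> \<in> space (\<Pi>\<^sub>M i\<in>insert m ?I. lborel). cmod (linear_form n W (torus_point \<theta>)) < s}
      \<in> sets (\<Pi>\<^sub>M i\<in>insert m ?I. lborel)"
    by measurable
  then have "indicator ?A \<in> borel_measurable (\<Pi>\<^sub>M i\<in>insert m ?I. lborel)"
    by (intro borel_measurable_indicator'[where f = "\<lambda>x. x"]) simp
  then have "torus_integral (insert m ?I) (indicator ?A) =
      torus_integral ?I (\<lambda>x. \<integral>\<^sup>+y\<in>{0..2 * pi}. indicator ?A (x(m := y)) \<partial>lborel)"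
    by (intro torus_integral_insert) auto
  also have "\<dots> = torus_integral ?I
      (\<lambda>x. emeasure lborel {y \<in> {0..2 * pi}. cmod (?b x + W m * exp (\<i> * of_real y)) < s})"
  proof -
    have "(\<integral>\<^sup>+y\<in>{0..2 * pi}. indicator ?A (x(m := y)) \<partial>lborel) =
        (\<integral>\<^sup>+y. indicator {y \<in> {0..2 * pi}. cmod (?b x + W m * exp (\<i> * of_real y)) < s} y \<partial>lborel)" for x
      by (intro nn_integral_cong) (auto simp: lf indicator_def simp del: fun_upd_apply)
    then show ?thesis by simp
  qed
  also have "\<dots> \<le> torus_integral ?I (\<lambda>x. ennreal (24 / cmod (W m) * s))"
    unfolding torus_integral_def
    using emeasure_small_circle_value[OF assms(2,3)]
    by (intro nn_integral_mono mult_right_mono) auto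
  also have "\<dots> = ennreal (24 / cmod (W m) * s) * ennreal ((2 * pi) ^ n)"
    using assms(1) by (subst torus_integral_const) auto
  finally show ?thesis
    using assms(3) unfolding I by (simp add: mult.assoc mult.commute mult.left_commute flip: ennreal_mult')
qed

text \<open>Cauchy-Schwarz against the all-ones vector of length n + 1. This explains the choice of
  c(D): it makes the quotient \<open>X\<close> of the final proof at most 1.\<close>

lemma norm_linear_form_torus_le:
  "(cmod (linear_form n W (torus_point \<theta>)))\<^sup>2 \<le> real (n + 1) * sq_norm_vec n W"
proof -
  have "cmod (linear_form n W (torus_point \<theta>)) \<le> (\<Sum>m\<le>n. cmod (W m))"
    unfolding linear_form_def
    by (intro order_trans[OF norm_sum]) (simp add: norm_mult torus_point_def)
  then have "(cmod (linear_form n W (torus_point \<theta>)))\<^sup>2 \<le> (\<Sum>m\<le>n. cmod (W m))\<^sup>2"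
    by (intro power_mono) auto
  also have "\<dots> \<le> (\<Sum>m\<le>n. (cmod (W m))\<^sup>2) * (\<Sum>m\<le>n. 1\<^sup>2)"
    using Cauchy_Schwarz_ineq_sum[of "\<lambda>m. cmod (W m)" "\<lambda>m. 1" "{..n}"] by simp
  finally show ?thesis by (simp add: sq_norm_vec_def mult.commute)
qed

section \<open>The logarithmic series under the integral\<close>

lemma sums_neg_ln:
  fixes x :: real
  assumes "0 < x" "x \<le> 1"
  shows "(\<lambda>i. (1 - x) ^ Suc i / real (Suc i)) sums - ln x"
proof -
  have "(\<lambda>i. - ((- (x - 1)) ^ i) / real i) sums ln (1 + (x - 1))"
    by (rule ln_series') (use assms in auto)
  then have "(\<lambda>i. (1 - x) ^ i / real i) sums - ln x"
    using sums_minus by fastforce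
  \<comment> \<open>The term of index 0 is a division by zero, hence 0, so shifting the index leaves
    the sum unchanged.\<close>
  then show ?thesis
    by (subst sums_Suc_iff) simp
qed

text \<open>The terms are non-negative because \<open>X\<close> is at most 1. Hence every partial
  sum lies between 0 and the limit, and the limit itself is the integrable majorant.\<close>

lemma integral_ln_sums:
  fixes X :: "'a \<Rightarrow> real"
  assumes "finite_measure M" and [measurable]: "X \<in> borel_measurable M"
    and bound: "\<And>x. x \<in> space M \<Longrightarrow> 0 \<le> X x \<and> X x \<le> 1"
    and pos: "AE x in M. X x > 0" and ln: "integrable M (\<lambda>x. ln (X x))"
  shows "(\<lambda>i. 1 / real (Suc i) * (\<integral>x. (1 - X x) ^ Suc i \<partial>M)) sums - (\<integral>x. ln (X x) \<partial>M)"
proof -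
  interpret finite_measure M by fact
  define f where "f = (\<lambda>i x. (1 - X x) ^ Suc i / real (Suc i))"
  have [measurable]: "f i \<in> borel_measurable M" for i
    unfolding f_def by measurable
  have f_int: "integrable M (f i)" for i
  proof (rule integrable_const_bound[of _ 1])
    show "AE x in M. norm (f i x) \<le> 1"
    proof (rule AE_I2)
      fix x assume "x \<in> space M"
      then have "\<bar>1 - X x\<bar> ^ Suc i \<le> 1"
        using bound[of x] by (intro power_le_one) auto
      then show "norm (f i x) \<le> 1"
        unfolding f_def by (simp add: power_abs abs_mult divide_le_eq)
    qed
  qed simp
  have "(\<lambda>N. \<integral>x. (\<Sum>i<N. f i x) \<partial>M) \<longlonglongrightarrow> (\<integral>x. - ln (X x) \<partial>M)"
  proof (rule integral_dominated_convergence[where w = "\<lambda>x. - ln (X x)"])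
    \<comment> \<open>Positivity matters here: at \<open>X x = 0\<close> the series is harmonic and
      diverges, while \<open>ln 0 = 0\<close>.\<close>
    show "AE x in M. (\<lambda>N. \<Sum>i<N. f i x) \<longlonglongrightarrow> - ln (X x)"
      using pos
    proof (rule AE_mp, intro AE_I2 impI)
      fix x assume "x \<in> space M" "X x > 0"
      then show "(\<lambda>N. \<Sum>i<N. f i x) \<longlonglongrightarrow> - ln (X x)"
        using sums_neg_ln[of "X x"] bound[of x] by (simp add: f_def sums_def)
    qed
    show "AE x in M. norm (\<Sum>i<N. f i x) \<le> - ln (X x)" for N
      using pos
    proof (rule AE_mp, intro AE_I2 impI)
      fix x assume x: "x \<in> space M" "X x > 0"
      then have s: "(\<lambda>i. f i x) sums - ln (X x)"
        using sums_neg_ln[of "X x"] bound[of x] by (simp add: f_def)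
      have nn: "f i x \<ge> 0" for i
        using bound[OF x(1)] by (simp add: f_def)
      then have "(\<Sum>i<N. f i x) \<le> (\<Sum>i. f i x)"
        using s by (intro sum_le_suminf) (auto simp: sums_iff)
      then show "norm (\<Sum>i<N. f i x) \<le> - ln (X x)"
        using s nn by (simp add: sums_iff sum_nonneg)
    qed
  qed (use ln in auto)
  moreover have "(\<integral>x. (\<Sum>i<N. f i x) \<partial>M) = (\<Sum>i<N. 1 / real (Suc i) * (\<integral>x. (1 - X x) ^ Suc i \<partial>M))" for N
    using f_int by (subst Bochner_Integration.integral_sum) (auto simp: f_def simp del: power_Suc)
  ultimately show ?thesis
    by (simp add: sums_def)
qed

section \<open>From the moments to the Mahler measure\<close>

theorem theorem1:
  fixes n :: nat and W :: "nat \<Rightarrow> complex" and c :: real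
  assumes "n \<ge> 3"
    and "\<exists>m\<le>n. W m \<noteq> 0"
    and "c > 0"
    and "c\<^sup>2 = real (n + 1) * sq_norm_vec n W"
  defines "t \<equiv> (\<lambda>j::nat. 1 / real j *
      (\<Sum>k\<le>j. real (j choose k) * ((-1) ^ k * a_coeff n k W / c ^ (2 * k))))"
  shows "log_mahler_defined (n + 1) (linear_form n W)
    \<and> summable (\<lambda>i. t (Suc i))
    \<and> log_mahler (n + 1) (linear_form n W) = ln c - 1 / 2 * (\<Sum>i. t (Suc i))"
proof -
  \<comment> \<open>Restricting Lebesgue measure to the box gives a finite measure of total mass
    \<open>V\<close>, to which the two general lemmas on logarithms apply. Normalisation is
    postponed to a division by \<open>V\<close>.\<close>
  define B where "B = restrict_space (angle_lebesgue (n + 1)) (angle_box (n + 1))"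
  define Y where "Y \<theta> = cmod (linear_form n W (torus_point \<theta>))" for \<theta>
  define X where "X \<theta> = (Y \<theta>)\<^sup>2 / c\<^sup>2" for \<theta>
  define V where "V = (2 * pi) ^ (n + 1)"
  have V: "V > 0" by (simp add: V_def)
  have index: "{..<n + 1} = {..n}" by auto
  have box: "angle_box (n + 1) \<in> sets (angle_lebesgue (n + 1))"
    unfolding angle_box_def angle_lebesgue_def by (rule sets_angle_PiE) simp
  have space_B: "space B = angle_box (n + 1)"
    using sets.sets_into_space[OF box] by (auto simp: B_def space_restrict_space)
  have nn_B: "(\<integral>\<^sup>+\<theta>. f \<theta> \<partial>B) = torus_integral {..n} f" for f
    unfolding B_def using box
    by (subst nn_integral_restrict_space)
      (auto simp: torus_integral_def angle_box_def angle_lebesgue_def lessThan_Suc_atMost)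
  have Y_meas [measurable]: "Y \<in> borel_measurable B"
    unfolding B_def Y_def angle_lebesgue_def index
    by (intro measurable_restrict_space1 borel_measurable_norm measurable_linear_form) auto
  have X_meas [measurable]: "X \<in> borel_measurable B"
    unfolding X_def by measurable
  have emeasure_B: "emeasure B (space B) = ennreal V"
    using nn_B[of "\<lambda>_. ennreal 1"] torus_integral_const[of "{..n}" 1] by (simp add: V_def)
  then have "finite_measure B"
    by (intro finite_measureI) simp
  then interpret B: finite_measure B .
  have measure_B: "measure B (space B) = V"
    using emeasure_B V by (simp add: measure_def)

  have Y_le: "(Y \<theta>)\<^sup>2 \<le> c\<^sup>2" for \<theta>
    unfolding Y_def assms(4) by (rule norm_linear_form_torus_le)
  then have Y_bound: "0 \<le> Y \<theta> \<and> Y \<theta> \<le> c" for \<theta>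
    using assms(3) power2_le_imp_le[OF Y_le] by (simp add: Y_def)
  have X_bound: "0 \<le> X \<theta> \<and> X \<theta> \<le> 1" for \<theta>
    using Y_le[of \<theta>] assms(3) by (simp add: X_def)

  obtain m where m: "m \<le> n" "W m \<noteq> 0" using assms(2) by auto
  have "(AE \<theta> in B. Y \<theta> > 0) \<and> integrable B (\<lambda>\<theta>. ln (Y \<theta>))"
  proof (rule integrable_ln_of_linear_tail)
    fix s :: real assume s: "s > 0"
    have "emeasure B {\<theta> \<in> space B. Y \<theta> < s} = (\<integral>\<^sup>+\<theta>. indicator {\<theta> \<in> space B. Y \<theta> < s} \<theta> \<partial>B)"
      by simp
    also have "\<dots> = (\<integral>\<^sup>+\<theta>. indicator {\<theta>. Y \<theta> < s} \<theta> \<partial>B)"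
      by (intro nn_integral_cong) (simp add: indicator_def)
    also have "\<dots> \<le> ennreal (24 * (2 * pi) ^ n / cmod (W m) * s)"
      unfolding nn_B Y_def by (rule torus_small_value[where W = W, OF m s])
    finally show "emeasure B {\<theta> \<in> space B. Y \<theta> < s} \<le> ennreal (24 * (2 * pi) ^ n / cmod (W m) * s)" .
  qed (use Y_bound \<open>finite_measure B\<close> in auto)
  then have Y_pos: "AE \<theta> in B. Y \<theta> > 0" and Y_int: "integrable B (\<lambda>\<theta>. ln (Y \<theta>))"
    by auto
  \<comment> \<open>Only almost everywhere: on the zero set of the form \<open>ln 0 = 0\<close>, and
    the identity would then require \<open>ln c = 0\<close>.\<close>
  have ln_X: "AE \<theta> in B. 2 * ln (Y \<theta>) - 2 * ln c = ln (X \<theta>)"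
    using Y_pos
    by (rule AE_mp) (intro AE_I2, use assms(3) in \<open>simp add: X_def ln_div ln_realpow\<close>)
  have X_int: "integrable B (\<lambda>\<theta>. ln (X \<theta>))"
    using Y_int by (intro integrable_cong_AE_imp[OF _ _ ln_X]) auto
  have "(\<integral>\<theta>. ln (X \<theta>) \<partial>B) = (\<integral>\<theta>. 2 * ln (Y \<theta>) - 2 * ln c \<partial>B)"
    using ln_X by (intro integral_cong_AE) auto
  also have "\<dots> = 2 * (\<integral>\<theta>. ln (Y \<theta>) \<partial>B) - 2 * ln c * V"
    using Y_int measure_B by simp
  finally have int_ln_X: "(\<integral>\<theta>. ln (X \<theta>) \<partial>B) = 2 * (\<integral>\<theta>. ln (Y \<theta>) \<partial>B) - 2 * ln c * V" .

  \<comment> \<open>A finite \<open>ennreal\<close> integral of a non-negative function yields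
    integrability and the value of the Bochner integral together.\<close>
  have Y_moment: "integrable B (\<lambda>\<theta>. Y \<theta> ^ (2 * k)) \<and> (\<integral>\<theta>. Y \<theta> ^ (2 * k) \<partial>B) = V * a_coeff n k W" for k
    using torus_moment[of n W k] V a_coeff_nonneg[of n k W]
    by (subst nn_integral_eq_integrable[symmetric]) (auto simp: nn_B Y_def[symmetric] V_def)
  have X_pow: "X \<theta> ^ k = Y \<theta> ^ (2 * k) / c ^ (2 * k)" for \<theta> k
    by (simp add: X_def power_divide power_mult)
  have moment: "(\<integral>\<theta>. (1 - X \<theta>) ^ j \<partial>B) =
      V * (\<Sum>k\<le>j. real (j choose k) * ((-1) ^ k * a_coeff n k W / c ^ (2 * k)))" for j
  proof -
    \<comment> \<open>Expanding in even powers of \<open>Y\<close> reduces the integral to the known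
      moments by linearity.\<close>
    have "(1 - X \<theta>) ^ j = (\<Sum>k\<le>j. real (j choose k) * (-1) ^ k / c ^ (2 * k) * Y \<theta> ^ (2 * k))" for \<theta>
    proof -
      have "(- X \<theta> + 1) ^ j = (\<Sum>k\<le>j. real (j choose k) * (- X \<theta>) ^ k * 1 ^ (j - k))"
        by (rule binomial_ring)
      then show ?thesis
        by (simp add: power_minus[of "X \<theta>"] X_pow mult.assoc)
    qed
    then show ?thesis
      using Y_moment by (simp add: Bochner_Integration.integral_sum sum_distrib_left ac_simps)
  qed
  have "(\<lambda>i. 1 / real (Suc i) * (\<integral>\<theta>. (1 - X \<theta>) ^ Suc i \<partial>B)) sums - (\<integral>\<theta>. ln (X \<theta>) \<partial>B)"
    using X_bound Y_pos X_int assms(3)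
    by (intro integral_ln_sums \<open>finite_measure B\<close>) (auto simp: X_def)
  then have "(\<lambda>i. V * t (Suc i)) sums - (\<integral>\<theta>. ln (X \<theta>) \<partial>B)"
    unfolding moment t_def by (simp only: mult.left_commute)
  then have "(\<lambda>i. V * t (Suc i) / V) sums (- (\<integral>\<theta>. ln (X \<theta>) \<partial>B) / V)"
    by (rule sums_divide)
  then have t_sums: "(\<lambda>i. t (Suc i)) sums (- (\<integral>\<theta>. ln (X \<theta>) \<partial>B) / V)"
    using V by simp
  have "log_mahler_defined (n + 1) (linear_form n W)"
    using Y_int box
    by (simp add: log_mahler_defined_def set_integrable_def B_def integrable_restrict_space Y_def)
  moreover have "log_mahler (n + 1) (linear_form n W) = (\<integral>\<theta>. ln (Y \<theta>) \<partial>B) / V"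
    using box
    by (simp add: log_mahler_def set_lebesgue_integral_def B_def integral_restrict_space Y_def V_def)
  \<comment> \<open>The series equals 2 * ln c minus twice the mean of \<open>ln Y\<close>; solving
    for that mean produces the factor 1 / 2.\<close>
  moreover have "(\<integral>\<theta>. ln (Y \<theta>) \<partial>B) / V = ln c - 1 / 2 * (\<Sum>i. t (Suc i))"
    using V by (simp add: sums_unique[OF t_sums, symmetric] int_ln_X field_simps)
  ultimately show ?thesis
    using sums_summable[OF t_sums] by simp
qed

end
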